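(* Let $G(B(3,n),B_Lb_D)$ be the two-bishop game graph on a $3\times n$ grid. Then $$3\leq \beta(G(B(3,n),B_Lb_D))\leq 4.$$
   Context: The bishop graph $B(a,b)$ is the simple graph whose vertices are the squares of an $a\times b$ grid, two distinct squares being adjacent if and only if a bishop can move from one to the other in chess, i.e. they lie on a common diagonal (in any diagonal direction, at any distance): squares $(i,j)\ne(i',j')$ are adjacent iff $|i-i'|=|j-j'|$. Colour the squares light and dark as on a chessboard (by the parity of $i+j$). $B_L(a,b)$ and $B_D(a,b)$ denote the subgraphs of $B(a,b)$ induced on the light and on the dark squares, respectively. $B_Lb_D$ denotes the position with a single bishop on one square of each colour (so that neither threatens the other). The game graph $G(B(a,b),B_Lb_D)$ is the Cartesian product $B_L(a,b)\,\square\,B_D(a,b)$ with each edge replaced by a pair of symmetric arcs, and it is treated as its underlying simple undirected graph $B_L(a,b)\,\square\,B_D(a,b)$. Here the Cartesian product $X\,\square\,Y$ has vertex set $V(X)\times V(Y)$, with $(x,y)$ and $(x',y')$ adjacent iff either $x=x'$ and $yy'$ is an edge of $Y$, or $y=y'$ and $xx'$ is an edge of $X$. Metric dimension: for an ordered set $S=(u_1,\dots,u_k)$ of vertices of a simple graph $G$, the distance vector of a vertex $v$ is $(d(u_1,v),\dots,d(u_k,v))$, where $d$ is the usual graph distance. $S$ is a resolving set if distinct vertices have distinct distance vectors. The metric dimension $\beta(G)$ is the minimum cardinality of a resolving set.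
   Formalization: The formal statement assumes n ≥ 3; the lower bound fails for smaller n, since for n = 2 the game graph is the 3×3 grid P3 □ P3, of metric dimension 2, and for n = 1 it is two isolated vertices, of metric dimension 1. *)

theory Defs
  imports Main "Graph_Theory.Graph_Theory" "HOL-Library.Extended_Nat" "HOL-Library.Extended_Real"
begin

text \<open>
  A simple graph is represented as in the library's locale \<open>pair_graph\<close>: a loop-free symmetric
  digraph without parallel arcs, every edge being a pair of opposite arcs.
\<close>

text \<open>
  The infimum over the empty set is \<open>\<infinity>\<close>, which is the distance between vertices in different
  components.
\<close>
definition graph_dist :: "('v, 'e) pre_digraph \<Rightarrow> 'v \<Rightarrow> 'v \<Rightarrow> enat" where
  "graph_dist G u v = (INF p \<in> {p. pre_digraph.awalk G u p v}. enat (length p))"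

definition distance_vector :: "('v, 'e) pre_digraph \<Rightarrow> 'v list \<Rightarrow> 'v \<Rightarrow> enat list" where
  "distance_vector G us v = map (\<lambda>u. graph_dist G u v) us"

definition resolving_set :: "('v, 'e) pre_digraph \<Rightarrow> 'v list \<Rightarrow> bool" where
  "resolving_set G us \<longleftrightarrow>
     distinct us \<and> set us \<subseteq> verts G \<and>
     (\<forall>v \<in> verts G. \<forall>w \<in> verts G. v \<noteq> w \<longrightarrow> distance_vector G us v \<noteq> distance_vector G us w)"

definition metric_dimension :: "('v, 'e) pre_digraph \<Rightarrow> nat" where
  "metric_dimension G = (LEAST k. \<exists>us. resolving_set G us \<and> length us = k)"

definition cartesian_product ::
  "('v, 'e) pre_digraph \<Rightarrow> ('w, 'f) pre_digraph \<Rightarrow> ('v \<times> 'w) pair_pre_digraph" where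
  "cartesian_product G H =
     \<lparr> pverts = verts G \<times> verts H,
       parcs = {((x, y), (x', y')).
         (x = x' \<and> x \<in> verts G \<and> y \<rightarrow>\<^bsub>H\<^esub> y') \<or> (y = y' \<and> y \<in> verts H \<and> x \<rightarrow>\<^bsub>G\<^esub> x')} \<rparr>"

definition bishop_graph :: "nat \<Rightarrow> nat \<Rightarrow> (nat \<times> nat) pair_pre_digraph" where
  "bishop_graph a b =
     \<lparr> pverts = {1..a} \<times> {1..b},
       parcs = {((i, j), (i', j')).
         (i, j) \<in> {1..a} \<times> {1..b} \<and> (i', j') \<in> {1..a} \<times> {1..b} \<and> (i, j) \<noteq> (i', j') \<and>
         \<bar>int i - int i'\<bar> = \<bar>int j - int j'\<bar>} \<rparr>"

text \<open>
  Which parity is called light is immaterial below: exchanging the colours exchanges the two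
  factors of the Cartesian product.
\<close>
definition light_bishop_graph :: "nat \<Rightarrow> nat \<Rightarrow> (nat \<times> nat, (nat \<times> nat) \<times> (nat \<times> nat)) pre_digraph"
  where "light_bishop_graph a b =
     with_proj (bishop_graph a b) \<restriction> {(i, j) \<in> pverts (bishop_graph a b). even (i + j)}"

definition dark_bishop_graph :: "nat \<Rightarrow> nat \<Rightarrow> (nat \<times> nat, (nat \<times> nat) \<times> (nat \<times> nat)) pre_digraph"
  where "dark_bishop_graph a b =
     with_proj (bishop_graph a b) \<restriction> {(i, j) \<in> pverts (bishop_graph a b). odd (i + j)}"

definition two_bishop_game_graph ::
  "nat \<Rightarrow> nat \<Rightarrow> ((nat \<times> nat) \<times> (nat \<times> nat)) pair_pre_digraph" where
  "two_bishop_game_graph a b = cartesian_product (light_bishop_graph a b) (dark_bishop_graph a b)"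

lemma pair_graph_bishop: "pair_graph (bishop_graph a b)"
proof
  show "finite (parcs (bishop_graph a b))"
    by (rule finite_subset[of _ "({1..a} \<times> {1..b}) \<times> ({1..a} \<times> {1..b})"])
      (auto simp: bishop_graph_def)
  show "symmetric (with_proj (bishop_graph a b))"
    by (auto simp: symmetric_def bishop_graph_def intro!: symI)
qed (auto simp: bishop_graph_def)

lemma graph_light: "graph (light_bishop_graph a b)"
  and graph_dark: "graph (dark_bishop_graph a b)"
proof -
  interpret pair_graph "bishop_graph a b" by (rule pair_graph_bishop)
  have *: "graph (with_proj (bishop_graph a b) \<restriction> S)" if "S \<subseteq> pverts (bishop_graph a b)" for S
  proof -
    have ind: "induced_subgraph (with_proj (bishop_graph a b) \<restriction> S) (with_proj (bishop_graph a b))"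
      using that by (rule induced_induce)
    have "digraph (with_proj (bishop_graph a b) \<restriction> S)"
      by (rule digraphI_induced[OF ind])
    moreover have "sym_digraph (with_proj (bishop_graph a b) \<restriction> S)"
      by (rule induced_graph_imp_graph[OF ind])
    ultimately show ?thesis
      by (simp add: graph_def pseudo_graph_def digraph_def)
  qed
  show "graph (light_bishop_graph a b)"
    unfolding light_bishop_graph_def by (rule *) auto
  show "graph (dark_bishop_graph a b)"
    unfolding dark_bishop_graph_def by (rule *) auto
qed

lemma pair_graph_cartesian_product:
  assumes "graph G" "graph H"
  shows "pair_graph (cartesian_product G H)"
proof -
  interpret G: graph G by fact
  interpret H: graph H by fact
  have sub: "parcs (cartesian_product G H) \<subseteq> (verts G \<times> verts H) \<times> (verts G \<times> verts H)"
    by (auto simp: cartesian_product_def)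
  show ?thesis
  proof
    show "finite (parcs (cartesian_product G H))"
      by (rule finite_subset[OF sub]) auto
    show "symmetric (with_proj (cartesian_product G H))"
      using G.sym_arcs H.sym_arcs
      by (auto simp: symmetric_def cartesian_product_def intro!: symI dest: symD)
  qed (use sub in \<open>auto simp: cartesian_product_def dest: G.adj_not_same H.adj_not_same\<close>)
qed

lemma pair_graph_two_bishop_game_graph: "pair_graph (two_bishop_game_graph a b)"
  unfolding two_bishop_game_graph_def
  by (rule pair_graph_cartesian_product[OF graph_light graph_dark])

lemma (in wf_digraph) graph_dist_eq_mu: "ereal_of_enat (graph_dist G u v) = \<mu> (\<lambda>_. 1) u v"
proof -
  have c: "awalk_cost (\<lambda>_. 1) p = real (length p)" for p
    by (induct p) auto
  show ?thesis
  proof (cases "{p. awalk u p v} = {}")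
    case True
    then show ?thesis
      unfolding graph_dist_def \<mu>_def True by (simp add: top_ereal_def top_enat_def)
  next
    case False
    then obtain p where p: "awalk u p v" "graph_dist G u v = enat (length p)"
      using wellorder_InfI[of _ "(\<lambda>p. enat (length p)) ` {p. awalk u p v}"]
      unfolding graph_dist_def by blast
    have le: "length p \<le> length q" if "awalk u q v" for q
      using that p(2) INF_lower[of q "{p. awalk u p v}" "\<lambda>p. enat (length p)"]
      by (simp add: graph_dist_def)
    have "\<mu> (\<lambda>_. 1) u v = ereal (real (length p))"
      unfolding \<mu>_def c by (rule INF_eqI) (use p(1) le in auto)
    then show ?thesis by (simp add: p(2))
  qed
qed

lemma graph_dist_eq_0_iff:
  assumes "u \<in> verts G"
  shows "graph_dist G u v = 0 \<longleftrightarrow> u = v"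
proof
  assume 0: "graph_dist G u v = 0"
  have "{p. pre_digraph.awalk G u p v} \<noteq> {}"
  proof
    assume "{p. pre_digraph.awalk G u p v} = {}"
    with 0 show False unfolding graph_dist_def by (simp add: top_enat_def)
  qed
  then obtain p where "pre_digraph.awalk G u p v" "graph_dist G u v = enat (length p)"
    using wellorder_InfI[of _ "(\<lambda>p. enat (length p)) ` {p. pre_digraph.awalk G u p v}"]
    unfolding graph_dist_def by blast
  with 0 show "u = v"
    by (simp add: zero_enat_def pre_digraph.awalk_def pre_digraph.cas.simps)
next
  assume "u = v"
  then have "pre_digraph.awalk G u [] v"
    using assms by (simp add: pre_digraph.awalk_def pre_digraph.cas.simps)
  then show "graph_dist G u v = 0"
    using INF_lower[of "[]" "{p. pre_digraph.awalk G u p v}" "\<lambda>p. enat (length p)"]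
    by (simp add: graph_dist_def zero_enat_def[symmetric])
qed

lemma metric_dimension_attained:
  assumes "finite (verts G)"
  shows "\<exists>us. resolving_set G us \<and> length us = metric_dimension G"
proof -
  obtain us where us: "set us = verts G" "distinct us"
    using finite_distinct_list[OF assms] by auto
  have "distance_vector G us v \<noteq> distance_vector G us w"
    if "v \<in> verts G" "w \<in> verts G" "v \<noteq> w" for v w
  proof
    assume "distance_vector G us v = distance_vector G us w"
    then have "graph_dist G v v = graph_dist G v w"
      using us that by (simp add: distance_vector_def)
    then show False
      using graph_dist_eq_0_iff[of v G] that by metis
  qed
  with us have "resolving_set G us" by (auto simp: resolving_set_def)
  then show ?thesis
    unfolding metric_dimension_def
    by (intro LeastI[of "\<lambda>k. \<exists>us. resolving_set G us \<and> length us = k" "length us"]) auto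
qed

end

theory Submission
  imports Defs
begin

text \<open>
  Distances in the Cartesian product are sums of distances in the two factors.

  Lower bound: all distances are at most \<open>n + 1\<close>, so with two landmarks the at least
  \<open>(9 * n\<^sup>2 - 1) / 4\<close> vertices would receive at most \<open>(n + 1)\<^sup>2 + 2\<close> distance vectors, the two
  extra ones coming from the landmarks themselves.

  Upper bound: take the landmarks \<open>(a, s)\<close>, \<open>(a, t)\<close>, \<open>(a, u)\<close>, \<open>(c, s)\<close>, where \<open>a\<close>, \<open>c\<close> are the light
  squares in the first column, \<open>s\<close>, \<open>t\<close> the dark squares in the second column and \<open>u\<close> is the last
  dark square of the middle row. Subtracting entries with the common component \<open>a\<close> eliminates the
  light square, and the differences of the distances to \<open>s\<close>, \<open>t\<close>, \<open>u\<close> already determine the dark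
  square; the distances to \<open>a\<close> and \<open>c\<close> then determine the light one.
\<close>

section \<open>Certifying graph distances by potentials\<close>

text \<open>A certificate that \<open>f\<close> is the distance from \<open>u\<close>: growth by at
  most one along arcs bounds walk lengths from below, and a smaller in-neighbour at every other
  vertex produces a short enough walk.\<close>

definition dist_function :: "('v, 'e) pre_digraph \<Rightarrow> 'v \<Rightarrow> ('v \<Rightarrow> nat) \<Rightarrow> bool" where
  "dist_function G u f \<longleftrightarrow> u \<in> verts G \<and> f u = 0 \<and>
     (\<forall>v w. v \<rightarrow>\<^bsub>G\<^esub> w \<longrightarrow> f w \<le> Suc (f v)) \<and>
     (\<forall>v \<in> verts G. v \<noteq> u \<longrightarrow> (\<exists>w. w \<rightarrow>\<^bsub>G\<^esub> v \<and> f w < f v))"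

lemma (in wf_digraph) awalk_potential_le:
  assumes "\<And>v w. v \<rightarrow>\<^bsub>G\<^esub> w \<Longrightarrow> f w \<le> Suc (f v)" and "awalk u p v"
  shows "f v \<le> f u + length p"
  using assms(2)
proof (induction p arbitrary: u)
  case Nil
  then show ?case by (simp add: awalk_Nil_iff)
next
  case (Cons e p)
  then have e: "e \<in> arcs G" "u = tail G e" and p: "awalk (head G e) p v"
    by (auto simp: awalk_Cons_iff)
  have "f (head G e) \<le> Suc (f u)"
    using assms(1)[of u "head G e"] e by (simp add: in_arcs_imp_in_arcs_ends)
  with Cons.IH[OF p] show ?case by simp
qed

text \<open>The walk is built backwards from \<open>v\<close>: each step to a smaller in-neighbour
  uses one arc and lowers \<open>f\<close> by at least one.\<close>

lemma (in wf_digraph) awalk_of_dist_function: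
  assumes "dist_function G u f" and "v \<in> verts G"
  shows "\<exists>p. awalk u p v \<and> length p \<le> f v"
  using assms(2)
proof (induction "f v" arbitrary: v rule: less_induct)
  case less
  show ?case
  proof (cases "v = u")
    case True
    with less.prems have "awalk u [] v" by (simp add: awalk_Nil_iff)
    then show ?thesis by fastforce
  next
    case False
    then obtain w where w: "w \<rightarrow>\<^bsub>G\<^esub> v" "f w < f v"
      using assms(1) less.prems unfolding dist_function_def by blast
    then obtain p where p: "awalk u p w" "length p \<le> f w"
      using less.hyps[of w] adj_in_verts(1) by blast
    from w(1) obtain e where e: "e \<in> arcs G" "tail G e = w" "head G e = v"
      by auto
    have "awalk u (p @ [e]) v"
      using p(1) e less.prems by (auto simp: awalk_Cons_iff awalk_Nil_iff)
    moreover have "length (p @ [e]) \<le> f v" using p(2) w(2) by simp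
    ultimately show ?thesis by blast
  qed
qed

lemma (in wf_digraph) graph_dist_eq_dist_function:
  assumes "dist_function G u f" and "v \<in> verts G"
  shows "graph_dist G u v = enat (f v)"
proof -
  have f: "f u = 0" "\<And>v w. v \<rightarrow>\<^bsub>G\<^esub> w \<Longrightarrow> f w \<le> Suc (f v)"
    using assms(1) by (auto simp: dist_function_def)
  have lower: "f v \<le> length p" if "awalk u p v" for p
    using awalk_potential_le[of f, OF f(2) that] f(1) by simp
  obtain p where p: "awalk u p v" "length p \<le> f v"
    using awalk_of_dist_function[OF assms] by blast
  show ?thesis
    unfolding graph_dist_def
  proof (rule antisym)
    show "(INF p \<in> {p. awalk u p v}. enat (length p)) \<le> enat (f v)"
      by (rule INF_lower2[of p]) (use p in auto)
    show "enat (f v) \<le> (INF p \<in> {p. awalk u p v}. enat (length p))"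
      by (rule INF_greatest) (use lower in auto)
  qed
qed

text \<open>An arc of the product moves one coordinate only, so the sum grows by at most one;
  descent happens in a coordinate that still differs from its target.\<close>

lemma dist_function_cartesian_product:
  assumes "dist_function G x f" and "dist_function H y g"
  shows "dist_function (with_proj (cartesian_product G H)) (x, y) (\<lambda>(a, b). f a + g b)"
proof -
  let ?P = "with_proj (cartesian_product G H)"
  have "\<exists>w. w \<rightarrow>\<^bsub>?P\<^esub> v \<and> (\<lambda>(a, b). f a + g b) w < (\<lambda>(a, b). f a + g b) v"
    if "v \<in> verts ?P" "v \<noteq> (x, y)" for v
  proof -
    obtain a b where v: "v = (a, b)" by (cases v)
    then have ab: "a \<in> verts G" "b \<in> verts H"
      using that(1) by (auto simp: cartesian_product_def)
    show ?thesis
    proof (cases "a = x")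
      case True
      then have "b \<noteq> y" using that(2) v by simp
      then obtain c where "c \<rightarrow>\<^bsub>H\<^esub> b" "g c < g b"
        using assms(2) ab(2) unfolding dist_function_def by blast
      then show ?thesis
        using ab v by (intro exI[of _ "(a, c)"]) (auto simp: cartesian_product_def)
    next
      case False
      then obtain c where "c \<rightarrow>\<^bsub>G\<^esub> a" "f c < f a"
        using assms(1) ab(1) unfolding dist_function_def by blast
      then show ?thesis
        using ab v by (intro exI[of _ "(c, b)"]) (auto simp: cartesian_product_def)
    qed
  qed
  then show ?thesis
    using assms unfolding dist_function_def
    by (auto simp: cartesian_product_def)
qed

section \<open>Counting distance vectors\<close>

text \<open>Outside the landmarks no entry is \<open>0\<close>, which leaves \<open>N\<close> values
  per entry; the landmarks are counted separately by the summand \<open>length us\<close>.\<close>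

lemma card_verts_le_of_resolving_set:
  assumes fin: "finite (verts G)" and res: "resolving_set G us"
    and bound: "\<And>u v. u \<in> verts G \<Longrightarrow> v \<in> verts G \<Longrightarrow> graph_dist G u v \<le> enat N"
  shows "card (verts G) \<le> N ^ length us + length us"
proof -
  let ?A = "enat ` {1..N}"
  let ?L = "{ds. set ds \<subseteq> ?A \<and> length ds = length us}"
  have us: "set us \<subseteq> verts G" using res by (simp add: resolving_set_def)
  have "inj_on (distance_vector G us) (verts G - set us)"
    using res by (auto simp: resolving_set_def inj_on_def)
  moreover have "distance_vector G us v \<in> ?L" if "v \<in> verts G - set us" for v
  proof -
    have "graph_dist G u v \<in> ?A" if u: "u \<in> set us" for u
    proof -
      have "graph_dist G u v \<noteq> 0"
        using graph_dist_eq_0_iff[of u G v] u us \<open>v \<in> verts G - set us\<close> by auto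
      moreover have "graph_dist G u v \<le> enat N"
        using bound u us \<open>v \<in> verts G - set us\<close> by auto
      ultimately show ?thesis
        by (cases "graph_dist G u v") (auto simp: zero_enat_def)
    qed
    then show ?thesis by (auto simp: distance_vector_def)
  qed
  ultimately have "card (verts G - set us) \<le> card ?L"
    by (intro card_inj_on_le[of "distance_vector G us"]) (auto intro: finite_lists_length_eq)
  also have "card ?L = card ?A ^ length us" by (rule card_lists_length_eq) simp
  also have "card ?A = N" by (subst card_image) (simp_all add: inj_on_def)
  finally have "card (verts G - set us) \<le> N ^ length us" .
  moreover have "card (verts G) \<le> card (verts G - set us) + card (set us)"
    using fin us by (metis card_Diff_subset card_mono finite_subset le_add_diff_inverse2 order_refl)
  ultimately show ?thesis using card_length[of us] by linarith
qed

section \<open>Bishop distances on three rows\<close>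

text \<open>
  The distance between squares of the same colour in rows \<open>i\<close> and \<open>k\<close> whose columns differ by \<open>d\<close>.
  A shortest path between the outer rows advances two columns per step and changes the row each
  time; it costs one extra step through the middle row if the parity is wrong.
\<close>
definition row_dist :: "nat \<Rightarrow> nat \<Rightarrow> nat \<Rightarrow> nat" where
  "row_dist i k d =
     (if odd d then Suc (d div 2)
      else if i = 2 then (if i = k \<and> d = 0 then 0 else Suc (d div 2))
      else if (i = k) = even (d div 2) then d div 2
      else if d = 0 then 2
      else Suc (d div 2))"

lemma row_dist_odd: "row_dist i k (Suc (2 * m)) = Suc m"
  by (simp add: row_dist_def)

lemma row_dist_even:
  "row_dist i k (2 * m) =
     (if i = 2 then (if i = k \<and> m = 0 then 0 else Suc m)
      else if (i = k) = even m then m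
      else if m = 0 then 2
      else Suc m)"
  by (simp add: row_dist_def)

text \<open>A move changes the column distance by one or two, so with \<open>2 * m\<close> or
  \<open>Suc (2 * m)\<close> as base the simplifier also meets these shifted forms.\<close>

lemma row_dist_even_Suc:
  "row_dist i k (Suc (Suc (2 * m))) =
     (if i \<noteq> 2 \<and> (i = k) = odd m then Suc m else Suc (Suc m))"
  using row_dist_even[of i k "Suc m"] by simp

lemma row_dist_odd_Suc: "row_dist i k (Suc (Suc (Suc (2 * m)))) = Suc (Suc m)"
  using row_dist_odd[of i k "Suc m"] by simp

lemmas row_dist_simps = row_dist_odd row_dist_even row_dist_even_Suc row_dist_odd_Suc

text \<open>Here \<open>e\<close> is the length of a move between rows \<open>k\<close> and
  \<open>k'\<close>. The first inequality treats a move away from the source column, the second the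
  same move reversed.\<close>

lemma row_dist_step:
  assumes "i \<in> {1, 2, 3}" "k \<in> {1, 2, 3}" "k' \<in> {1, 2, 3}" "k \<noteq> k'" "even (i + k + d)"
    and "e = (k - k') + (k' - k)"
  shows "row_dist i k' (d + e) \<le> Suc (row_dist i k d) \<and>
    row_dist i k d \<le> Suc (row_dist i k' (d + e))"
proof (cases "even d")
  case True
  then obtain m where "d = 2 * m" by blast
  with assms(1-3) assms(4-) show ?thesis
    by (elim insertE emptyE) (simp_all add: row_dist_simps)
next
  case False
  then obtain m where "d = Suc (2 * m)" by (auto elim: oddE)
  with assms(1-3) assms(4-) show ?thesis
    by (elim insertE emptyE) (simp_all add: row_dist_simps)
qed

text \<open>Some move towards the source column always helps: two columns where possible, or one
  column when that brings the parity or the row right.\<close>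

lemma row_dist_descent:
  assumes "i \<in> {1, 2, 3}" "k \<in> {1, 2, 3}" "even (i + k + d)" "0 < d"
  shows "\<exists>k' \<in> {1, 2, 3}. k' \<noteq> k \<and> (k - k') + (k' - k) \<le> d \<and>
    row_dist i k' (d - ((k - k') + (k' - k))) < row_dist i k d"
proof -
  consider "d = Suc (2 * 0)" | a where "d = Suc (Suc a)" "even a" | a where "d = Suc (Suc a)" "odd a"
    using \<open>0 < d\<close> by (metis One_nat_def mult_0_right not0_implies_Suc not_gr_zero)
  then show ?thesis
  proof cases
    case 1
    with assms(1,2) assms(3) show ?thesis
      by (elim insertE emptyE) (simp_all add: row_dist_def)
  next
    case 2
    then obtain m where "d = Suc (Suc (2 * m))" by blast
    with assms(1,2) assms(3) show ?thesis
      by (elim insertE emptyE) (simp_all add: row_dist_simps)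
  next
    case 3
    then obtain m where "d = Suc (Suc (Suc (2 * m)))" by (auto elim: oddE)
    with assms(1,2) assms(3) show ?thesis
      by (elim insertE emptyE) (simp_all add: row_dist_simps)
  qed
qed

text \<open>Equal distances to both corners mark the middle row. Otherwise the smaller one is
  \<open>d div 2\<close>, and its parity together with the nearer corner gives the outer
  row.\<close>

lemma row_dist_from_corners_inject:
  assumes "k \<in> {1, 2, 3}" "k' \<in> {1, 2, 3}" "odd (k + d)" "odd (k' + d')"
    and "row_dist 1 k d = row_dist 1 k' d'" "row_dist 3 k d = row_dist 3 k' d'"
  shows "k = k' \<and> d = d'"
proof -
  have parity: "\<exists>m. d = 2 * m \<or> d = Suc (2 * m)" for d :: nat
    by presburger
  obtain m m' where "d = 2 * m \<or> d = Suc (2 * m)" "d' = 2 * m' \<or> d' = Suc (2 * m')"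
    using parity by metis
  with assms(1,2) assms(3-) show ?thesis
    by (elim disjE insertE emptyE) (simp_all add: row_dist_simps split: if_splits)
qed

text \<open>One of the two truncated differences is always \<open>0\<close>, so their sum is the
  absolute column difference.\<close>

definition bishop_dist :: "nat \<times> nat \<Rightarrow> nat \<times> nat \<Rightarrow> nat" where
  "bishop_dist u v = row_dist (fst u) (fst v) ((snd u - snd v) + (snd v - snd u))"

definition colour_graph :: "nat \<Rightarrow> bool \<Rightarrow> (nat \<times> nat, (nat \<times> nat) \<times> (nat \<times> nat)) pre_digraph"
  where "colour_graph n c =
    with_proj (bishop_graph 3 n) \<restriction> {(i, j) \<in> pverts (bishop_graph 3 n). even (i + j) = c}"

lemma light_eq_colour_graph: "light_bishop_graph 3 n = colour_graph n True"
  and dark_eq_colour_graph: "dark_bishop_graph 3 n = colour_graph n False"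
  by (simp_all add: light_bishop_graph_def dark_bishop_graph_def colour_graph_def)

lemma in_verts_colour_graph:
  "(i, j) \<in> verts (colour_graph n c) \<longleftrightarrow>
     i \<in> {1, 2, 3} \<and> 1 \<le> j \<and> j \<le> n \<and> even (i + j) = c"
  by (auto simp: colour_graph_def bishop_graph_def)

lemma colour_graph_adj_iff:
  "(i, j) \<rightarrow>\<^bsub>colour_graph n c\<^esub> (k, l) \<longleftrightarrow>
     (i, j) \<in> verts (colour_graph n c) \<and> (k, l) \<in> verts (colour_graph n c) \<and>
     (i, j) \<noteq> (k, l) \<and> \<bar>int i - int k\<bar> = \<bar>int j - int l\<bar>"
  by (auto simp: colour_graph_def bishop_graph_def arcs_ends_def arc_to_ends_def)

lemma bishop_dist_adj_le:
  assumes "u \<in> verts (colour_graph n c)" and "v \<rightarrow>\<^bsub>colour_graph n c\<^esub> w"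
  shows "bishop_dist u w \<le> Suc (bishop_dist u v)"
proof -
  obtain i j k l k' l' where e: "u = (i, j)" "v = (k, l)" "w = (k', l')"
    by (metis surj_pair)
  have u: "i \<in> {1, 2, 3}" "even (i + j) = c" and v: "k \<in> {1, 2, 3}" "even (k + l) = c"
    and w: "k' \<in> {1, 2, 3}" "even (k' + l') = c"
    and adj: "(k, l) \<noteq> (k', l')" "\<bar>int k - int k'\<bar> = \<bar>int l - int l'\<bar>"
    using assms unfolding e colour_graph_adj_iff by (auto simp: in_verts_colour_graph)
  define d d' e where "d = (j - l) + (l - j)" and "d' = (j - l') + (l' - j)"
    and "e = (k - k') + (k' - k)"
  have kk: "k \<noteq> k'" using adj by auto
  have e2: "e = 1 \<or> e = 2" using v(1) w(1) kk unfolding e_def by auto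
  have "l' = l + e \<or> l = l' + e" using adj(2) unfolding e_def by linarith
  \<comment> \<open>The move leads away from column \<open>j\<close>, towards it, or across it;
    crossing takes a move of length two from one adjacent column to the other.\<close>
  then consider "d' = d + e" | "d = d' + e" | "d = 1" "d' = 1"
    using e2 unfolding d_def d'_def by linarith
  then have "row_dist i k' d' \<le> Suc (row_dist i k d)"
  proof cases
    case 1
    have "even (i + j) = even (k + l)" using u(2) v(2) by simp
    then have "even (i + k + d)" unfolding d_def by presburger
    with row_dist_step[OF u(1) v(1) w(1) kk _ e_def] 1 show ?thesis by blast
  next
    case 2
    have "even (i + j) = even (k' + l')" using u(2) w(2) by simp
    then have "even (i + k' + d')" unfolding d'_def by presburger
    moreover have "e = (k' - k) + (k - k')" by (simp add: e_def)
    ultimately show ?thesis using row_dist_step[OF u(1) w(1) v(1) kk[symmetric]] 2 by blast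
  next
    case 3
    then show ?thesis by (simp add: row_dist_def)
  qed
  then show ?thesis by (simp add: bishop_dist_def e d_def d'_def)
qed

lemma bishop_dist_descent:
  assumes "n \<ge> 2" and "u \<in> verts (colour_graph n c)"
    and "v \<in> verts (colour_graph n c)" and "v \<noteq> u"
  shows "\<exists>w. w \<rightarrow>\<^bsub>colour_graph n c\<^esub> v \<and> bishop_dist u w < bishop_dist u v"
proof -
  obtain i j k l where e: "u = (i, j)" "v = (k, l)" by (metis surj_pair)
  have u: "i \<in> {1, 2, 3}" "even (i + j) = c" "1 \<le> j" "j \<le> n"
    and v: "k \<in> {1, 2, 3}" "even (k + l) = c" "1 \<le> l" "l \<le> n"
    using assms(2,3) unfolding e in_verts_colour_graph by auto
  show ?thesis
  proof (cases "j = l")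
    case True
    then have ik: "i \<noteq> k" "i \<noteq> 2" "k \<noteq> 2" "even (k + i)"
      using assms(4) u v unfolding e by auto
    \<comment> \<open>Two squares of one colour in one column lie in the outer rows and are joined
      through the middle row of a neighbouring column, which exists as
      \<open>n \<ge> 2\<close>.\<close>
    define l' where "l' = (if l = 1 then l + 1 else l - 1)"
    have l': "1 \<le> l'" "l' \<le> n" "l' + 1 = l \<or> l' = l + 1"
      using assms(1) v(3,4) unfolding l'_def by auto
    then have "(j - l') + (l' - j) = 1" using True by auto
    then have "bishop_dist u (2, l') < bishop_dist u v"
      using True ik by (simp add: bishop_dist_def e row_dist_def)
    moreover have "(2, l') \<rightarrow>\<^bsub>colour_graph n c\<^esub> v"
      using l' v ik(3) unfolding e colour_graph_adj_iff in_verts_colour_graph by auto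
    ultimately show ?thesis by blast
  next
    case False
    define d where "d = (j - l) + (l - j)"
    have "0 < d" using False unfolding d_def by linarith
    have "even (i + j) = even (k + l)" using u(2) v(2) by simp
    then have "even (i + k + d)" unfolding d_def by presburger
    with \<open>0 < d\<close> obtain k' where k': "k' \<in> {1, 2, 3}" "k' \<noteq> k" "(k - k') + (k' - k) \<le> d"
      "row_dist i k' (d - ((k - k') + (k' - k))) < row_dist i k d"
      using row_dist_descent[OF u(1) v(1)] by blast
    define m where "m = (k - k') + (k' - k)"
    \<comment> \<open>The move goes towards column \<open>j\<close> and, as
      \<open>m \<le> d\<close>, does not pass it, so it stays on the board.\<close>
    define l' where "l' = (if l < j then l + m else l - m)"
    have md: "m \<le> d" using k'(3) by (simp add: m_def)
    have l': "1 \<le> l'" "l' \<le> n" "l' = l + m \<or> l = l' + m" "(j - l') + (l' - j) = d - m"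
      using md u(3,4) v(3,4) unfolding l'_def d_def by auto
    have "bishop_dist u (k', l') < bishop_dist u v"
      using k'(4) l'(4) by (simp add: bishop_dist_def e d_def m_def)
    moreover have "even (k' + l') = even (k + l)" using l'(3) unfolding m_def by presburger
    moreover have "\<bar>int k' - int k\<bar> = \<bar>int l' - int l\<bar>" using l'(3) unfolding m_def by linarith
    ultimately show ?thesis
      using k'(1,2) l'(1,2) v unfolding e
      by (intro exI[of _ "(k', l')"]) (simp add: colour_graph_adj_iff in_verts_colour_graph)
  qed
qed

lemma dist_function_bishop_dist:
  assumes "n \<ge> 2" and "u \<in> verts (colour_graph n c)"
  shows "dist_function (colour_graph n c) u (bishop_dist u)"
proof -
  have "bishop_dist u u = 0" by (simp add: bishop_dist_def row_dist_def)
  then show ?thesis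
    using assms bishop_dist_adj_le[OF assms(2)] bishop_dist_descent[OF assms]
    unfolding dist_function_def by blast
qed

text \<open>Column differences are at most \<open>n - 1\<close>; \<open>n \<ge> 3\<close> makes room
  for the distance \<open>2\<close> between the outer squares of one column.\<close>

lemma bishop_dist_le:
  assumes "n \<ge> 3" and "u \<in> verts (colour_graph n c)" and "v \<in> verts (colour_graph n c)"
  shows "bishop_dist u v \<le> (n + 1) div 2"
proof -
  obtain i j k l where e: "u = (i, j)" "v = (k, l)" by (metis surj_pair)
  define d where "d = (j - l) + (l - j)"
  have "d + 1 \<le> n"
    using assms(2,3) unfolding e d_def in_verts_colour_graph by linarith
  then have "(d + 1) div 2 \<le> (n + 1) div 2" "even d \<Longrightarrow> d div 2 + 1 \<le> (n + 1) div 2"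
    "2 \<le> (n + 1) div 2"
    using assms(1) by presburger+
  then show ?thesis
    unfolding e bishop_dist_def fst_conv snd_conv d_def[symmetric] row_dist_def by auto
qed

lemma finite_verts_colour_graph: "finite (verts (colour_graph n c))"
  by (rule finite_subset[of _ "{1..3} \<times> {1..n}"])
    (auto simp: colour_graph_def bishop_graph_def)

lemma card_verts_colour_graph:
  "card (verts (colour_graph n True)) = (3 * n + 1) div 2"
  "card (verts (colour_graph n False)) = 3 * n div 2"
proof (induction n)
  case 0
  have "verts (colour_graph 0 c) = {}" for c
    by (auto simp: colour_graph_def bishop_graph_def)
  then show "card (verts (colour_graph 0 True)) = (3 * 0 + 1) div 2"
    "card (verts (colour_graph 0 False)) = 3 * 0 div 2" by simp_all
next
  case (Suc n)
  have step: "verts (colour_graph (Suc n) c) = verts (colour_graph n c) \<union>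
      (if even (Suc n) = c then {(2, Suc n)} else {(1, Suc n), (3, Suc n)})" for c
    by (auto simp: in_verts_colour_graph le_Suc_eq split: if_splits)
  have "card (verts (colour_graph (Suc n) c)) = card (verts (colour_graph n c)) +
      (if even (Suc n) = c then 1 else 2)" for c
    unfolding step
    by (subst card_Un_disjoint) (auto simp: in_verts_colour_graph finite_verts_colour_graph)
  then show "card (verts (colour_graph (Suc n) True)) = (3 * Suc n + 1) div 2"
    "card (verts (colour_graph (Suc n) False)) = 3 * Suc n div 2"
    using Suc.IH by (auto elim!: evenE oddE)
qed

section \<open>Distances in the game graph\<close>

lemma graph_dist_two_bishop_game_graph:
  assumes "n \<ge> 2" and "x \<in> verts (colour_graph n True)" "y \<in> verts (colour_graph n False)"
    and "x' \<in> verts (colour_graph n True)" "y' \<in> verts (colour_graph n False)"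
  shows "graph_dist (with_proj (two_bishop_game_graph 3 n)) (x, y) (x', y') =
    enat (bishop_dist x x' + bishop_dist y y')"
proof -
  interpret pair_graph "two_bishop_game_graph 3 n"
    by (rule pair_graph_two_bishop_game_graph)
  have "dist_function (with_proj (two_bishop_game_graph 3 n)) (x, y)
      (\<lambda>(a, b). bishop_dist x a + bishop_dist y b)"
    unfolding two_bishop_game_graph_def light_eq_colour_graph dark_eq_colour_graph
    using assms by (intro dist_function_cartesian_product dist_function_bishop_dist)
  moreover have "(x', y') \<in> verts (with_proj (two_bishop_game_graph 3 n))"
    using assms by (simp add: two_bishop_game_graph_def cartesian_product_def
        light_eq_colour_graph dark_eq_colour_graph)
  ultimately show ?thesis
    using graph_dist_eq_dist_function by fastforce
qed

lemma verts_two_bishop_game_graph: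
  "verts (with_proj (two_bishop_game_graph 3 n)) =
     verts (colour_graph n True) \<times> verts (colour_graph n False)"
  by (simp add: two_bishop_game_graph_def cartesian_product_def
        light_eq_colour_graph dark_eq_colour_graph)

section \<open>Lower bound\<close>

lemma metric_dimension_two_bishop_ge:
  assumes "n \<ge> 3"
  shows "3 \<le> metric_dimension (with_proj (two_bishop_game_graph 3 n))"
proof (rule ccontr)
  let ?G = "with_proj (two_bishop_game_graph 3 n)"
  interpret pair_graph "two_bishop_game_graph 3 n"
    by (rule pair_graph_two_bishop_game_graph)
  assume "\<not> 3 \<le> metric_dimension ?G"
  moreover obtain us where us: "resolving_set ?G us" "length us = metric_dimension ?G"
    using metric_dimension_attained[of ?G] finite_verts by auto
  ultimately have len: "length us \<le> 2" by simp
  have bound: "graph_dist ?G u v \<le> enat (n + 1)" if "u \<in> verts ?G" "v \<in> verts ?G" for u v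
  proof -
    obtain x y x' y' where e: "u = (x, y)" "v = (x', y')" by (metis surj_pair)
    then have m: "x \<in> verts (colour_graph n True)" "y \<in> verts (colour_graph n False)"
      "x' \<in> verts (colour_graph n True)" "y' \<in> verts (colour_graph n False)"
      using that unfolding verts_two_bishop_game_graph by auto
    have "bishop_dist x x' + bishop_dist y y' \<le> (n + 1) div 2 + (n + 1) div 2"
      by (intro add_mono bishop_dist_le[OF assms]) (use m in auto)
    then show ?thesis
      using graph_dist_two_bishop_game_graph[OF _ m] assms e by simp
  qed
  have "card (verts ?G) \<le> (n + 1) ^ length us + length us"
    by (rule card_verts_le_of_resolving_set[OF _ us(1) bound]) (use finite_verts in auto)
  also have "\<dots> \<le> (n + 1) ^ 2 + 2"
    by (intro add_mono power_increasing) (use len in auto)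
  finally have "((3 * n + 1) div 2) * (3 * n div 2) \<le> (n + 1) ^ 2 + 2"
    by (simp only: verts_two_bishop_game_graph card_cartesian_product card_verts_colour_graph)
  \<comment> \<open>With \<open>n = 2 * q + 4\<close> or \<open>n = 2 * q + 3\<close> both sides are
    polynomials in \<open>q\<close> that compare coefficientwise; for \<open>n = 3\<close> the
    inequality reads \<open>18 < 20\<close>.\<close>
  moreover have "(n + 1) ^ 2 + 2 < ((3 * n + 1) div 2) * (3 * n div 2)"
  proof (cases "even n")
    case True
    then obtain m where m: "n = 2 * m" by auto
    then have "2 \<le> m" using assms by simp
    then obtain q where "m = 2 + q" using le_Suc_ex by blast
    with m have *: "n = 2 * q + 4" by simp
    have "(3 * n + 1) div 2 = 3 * q + 6" "3 * n div 2 = 3 * q + 6" using * by auto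
    with * show ?thesis by (simp add: power2_eq_square algebra_simps)
  next
    case False
    then obtain m where m: "n = 2 * m + 1" by (auto elim: oddE)
    then have "1 \<le> m" using assms by simp
    then obtain q where "m = 1 + q" using le_Suc_ex by blast
    with m have *: "n = 2 * q + 3" by simp
    have "(3 * n + 1) div 2 = 3 * q + 5" "3 * n div 2 = 3 * q + 4" using * by auto
    with * show ?thesis by (simp add: power2_eq_square algebra_simps)
  qed
  ultimately show False by simp
qed

section \<open>Upper bound\<close>

lemma light_corners_resolve:
  assumes "x \<in> verts (colour_graph n True)" and "x' \<in> verts (colour_graph n True)"
    and "bishop_dist (1, 1) x = bishop_dist (1, 1) x'"
    and "bishop_dist (3, 1) x = bishop_dist (3, 1) x'"
  shows "x = x'"
proof -
  obtain i j i' j' where e: "x = (i, j)" "x' = (i', j')" by (metis surj_pair)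
  have x: "i \<in> {1, 2, 3}" "even (i + j)" "1 \<le> j" and x': "i' \<in> {1, 2, 3}" "even (i' + j')" "1 \<le> j'"
    using assms(1,2) unfolding e in_verts_colour_graph by auto
  \<comment> \<open>The corners lie in column 1, so the column distance is \<open>j - 1\<close> and
    the parity flips.\<close>
  have o: "odd (i + (j - 1))" "odd (i' + (j' - 1))" using x x' by presburger+
  have "row_dist r i (j - 1) = bishop_dist (r, 1) x"
    "row_dist r i' (j' - 1) = bishop_dist (r, 1) x'" for r
    using x(3) x'(3) by (simp_all add: bishop_dist_def e)
  then have "row_dist 1 i (j - 1) = row_dist 1 i' (j' - 1)"
    "row_dist 3 i (j - 1) = row_dist 3 i' (j' - 1)"
    by (simp_all only: assms(3,4))
  then have "i = i' \<and> j - 1 = j' - 1"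
    by (rule row_dist_from_corners_inject[OF x(1) x'(1) o])
  with x(3) x'(3) have "i = i'" "j = j'" by linarith+
  then show ?thesis by (simp add: e)
qed

text \<open>
  The possible distances \<open>s\<close>, \<open>t\<close>, \<open>u\<close> of the dark square \<open>(i, j)\<close> from \<open>(1, 2)\<close>, \<open>(3, 2)\<close> and
  \<open>(2, 2 * k + 1)\<close>.
\<close>
definition landmark_profile :: "nat \<Rightarrow> nat \<Rightarrow> nat \<Rightarrow> nat \<Rightarrow> nat \<Rightarrow> nat \<Rightarrow> bool" where
  "landmark_profile k i j s t u \<longleftrightarrow> (\<exists>p \<le> k.
     (i = 2 \<and> j = 2 * p + 1 \<and> s = max p 1 \<and> t = s \<and> u = (if p = k then 0 else k - p + 1)) \<or>
     (i = 1 \<and> j = 2 * p + 2 \<and> s = (if even p then p else p + 1) \<and>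
       t = (if p = 0 then 2 else if even p then p + 1 else p) \<and> u = max 1 (k - p)) \<or>
     (i = 3 \<and> j = 2 * p + 2 \<and> t = (if even p then p else p + 1) \<and>
       s = (if p = 0 then 2 else if even p then p + 1 else p) \<and> u = max 1 (k - p)))"

text \<open>The difference \<open>t - s\<close> is \<open>0\<close> exactly in the middle row and
  \<open>2\<close> or \<open>-2\<close> exactly for \<open>p = 0\<close> in the outer rows. For each
  fixed value of \<open>t - s\<close>, \<open>u - s\<close> strictly decreases in \<open>p\<close>;
  if \<open>t - s\<close> is \<open>1\<close> or \<open>-1\<close>, the parity of \<open>p\<close>
  then gives the row.\<close>

lemma landmark_profile_inject:
  assumes "landmark_profile k i j s t u" and "landmark_profile k i' j' s' t' u'" and "1 \<le> k"
    and "int t - int s = int t' - int s'" and "int u - int s = int u' - int s'"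
  shows "i = i' \<and> j = j'"
  using assms unfolding landmark_profile_def max_def
  by (elim exE conjE disjE) (simp_all split: if_splits)

lemma landmark_profile_row_dist:
  assumes "i \<in> {1, 2, 3}" "odd (i + j)" "1 \<le> j" "j \<le> 2 * k + 2"
  shows "landmark_profile k i j (row_dist 1 i ((2 - j) + (j - 2))) (row_dist 3 i ((2 - j) + (j - 2)))
    (row_dist 2 i ((2 * k + 1 - j) + (j - (2 * k + 1))))"
    (is "landmark_profile k i j ?s ?t ?u")
proof (cases "i = 2")
  case True
  then obtain p where p: "j = 2 * p + 1" using assms(2) by (auto elim: oddE)
  have pk: "p \<le> k" using p assms by auto
  \<comment> \<open>The maximum accounts for column 1, which lies on the other side of column
    2.\<close>
  have "?s = max p 1" "?t = ?s" using True p by (cases p; simp add: row_dist_def)+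
  moreover have "(2 * k + 1 - j) + (j - (2 * k + 1)) = 2 * (k - p)" using p pk by simp
  then have "?u = (if p = k then 0 else k - p + 1)"
    using True pk by (simp add: row_dist_def)
  ultimately show ?thesis
    unfolding landmark_profile_def using True p pk by blast
next
  case False
  then have "even j" using assms(1,2) by auto
  then obtain m where m: "j = 2 * m" by blast
  then have "1 \<le> m" using assms(3) by simp
  then obtain p where "m = 1 + p" using le_Suc_ex by blast
  with m have p: "j = 2 * p + 2" by simp
  have pk: "p \<le> k" using p assms by auto
  have d2: "(2 - j) + (j - 2) = 2 * p" using p by simp
  \<comment> \<open>For \<open>p = k\<close> the square is one column to the right of the third
    landmark; all other outer squares are to its left.\<close>
  have "(2 * k + 1 - j) + (j - (2 * k + 1)) = (if p = k then 1 else 2 * (k - p) - 1)"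
    using p pk by auto
  then have u: "?u = max 1 (k - p)"
    using pk by (auto simp: row_dist_def max_def)
  have same: "row_dist r r (2 * p) = (if even p then p else p + 1)"
    and other: "r' \<noteq> r \<Longrightarrow> row_dist r r' (2 * p) =
      (if p = 0 then 2 else if even p then p + 1 else p)"
    if "r \<noteq> 2" for r r'
    using that unfolding row_dist_even by auto
  from False assms(1) consider "i = 1" | "i = 3" by auto
  then show ?thesis
  proof cases
    case 1
    then have "?s = (if even p then p else p + 1)"
      "?t = (if p = 0 then 2 else if even p then p + 1 else p)"
      unfolding d2 using same[of 1] other[of 3 1] by simp_all
    with 1 p pk u show ?thesis unfolding landmark_profile_def by blast
  next
    case 2
    then have "?t = (if even p then p else p + 1)"
      "?s = (if p = 0 then 2 else if even p then p + 1 else p)"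
      unfolding d2 using same[of 3] other[of 1 3] by simp_all
    with 2 p pk u show ?thesis unfolding landmark_profile_def by blast
  qed
qed

lemma dark_differences_resolve:
  assumes "y \<in> verts (colour_graph n False)" and "y' \<in> verts (colour_graph n False)"
    and "odd w" "3 \<le> w" "n \<le> w + 1"
    and t: "int (bishop_dist (3, 2) y) - int (bishop_dist (1, 2) y)
       = int (bishop_dist (3, 2) y') - int (bishop_dist (1, 2) y')"
    and u: "int (bishop_dist (2, w) y) - int (bishop_dist (1, 2) y)
       = int (bishop_dist (2, w) y') - int (bishop_dist (1, 2) y')"
  shows "y = y'"
proof -
  obtain i j i' j' where e: "y = (i, j)" "y' = (i', j')" by (metis surj_pair)
  obtain k where w: "w = 2 * k + 1" using \<open>odd w\<close> by (auto elim: oddE)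
  with \<open>3 \<le> w\<close> have k: "1 \<le> k" by simp
  have y: "i \<in> {1, 2, 3}" "odd (i + j)" "1 \<le> j" "j \<le> 2 * k + 2"
    and y': "i' \<in> {1, 2, 3}" "odd (i' + j')" "1 \<le> j'" "j' \<le> 2 * k + 2"
    using assms(1,2,5) unfolding e w in_verts_colour_graph by auto
  show ?thesis
    using landmark_profile_inject[OF landmark_profile_row_dist[OF y] landmark_profile_row_dist[OF y'] k
        t[unfolded e bishop_dist_def fst_conv snd_conv]
        u[unfolded e w bishop_dist_def fst_conv snd_conv]]
    by (simp add: e)
qed

lemma metric_dimension_two_bishop_le:
  assumes "n \<ge> 3"
  shows "metric_dimension (with_proj (two_bishop_game_graph 3 n)) \<le> 4"
proof -
  let ?G = "with_proj (two_bishop_game_graph 3 n)"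
  \<comment> \<open>The last odd column: dark squares of the middle row have odd column.\<close>
  define w where "w = (if odd n then n else n - 1)"
  have w: "odd w" "3 \<le> w" "n \<le> w + 1" "w \<le> n"
    using assms by (auto simp: w_def) presburger
  have L: "(1, 1) \<in> verts (colour_graph n True)" "(3, 1) \<in> verts (colour_graph n True)"
    and D: "(1, 2) \<in> verts (colour_graph n False)" "(3, 2) \<in> verts (colour_graph n False)"
      "(2, w) \<in> verts (colour_graph n False)"
    using assms w by (auto simp: in_verts_colour_graph)
  define us where "us =
    [((1::nat, 1::nat), (1::nat, 2::nat)), ((1, 1), (3, 2)), ((1, 1), (2, w)), ((3, 1), (1, 2))]"
  have "resolving_set ?G us"
    unfolding resolving_set_def
  proof (intro conjI ballI impI notI)
    show "distinct us" by (simp add: us_def)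
    show "set us \<subseteq> verts ?G"
      unfolding verts_two_bishop_game_graph us_def using L D by simp
    fix v v' assume v: "v \<in> verts ?G" "v' \<in> verts ?G" "v \<noteq> v'"
      and eq: "distance_vector ?G us v = distance_vector ?G us v'"
    obtain x y x' y' where e: "v = (x, y)" "v' = (x', y')" by (metis surj_pair)
    then have m: "x \<in> verts (colour_graph n True)" "y \<in> verts (colour_graph n False)"
      and m': "x' \<in> verts (colour_graph n True)" "y' \<in> verts (colour_graph n False)"
      using v unfolding verts_two_bishop_game_graph by auto
    have n2: "2 \<le> n" using assms by simp
    note gd = graph_dist_two_bishop_game_graph[OF n2 _ _ m]
      graph_dist_two_bishop_game_graph[OF n2 _ _ m']
    have d:
      "bishop_dist (1, 1) x + bishop_dist (1, 2) y = bishop_dist (1, 1) x' + bishop_dist (1, 2) y'"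
      "bishop_dist (1, 1) x + bishop_dist (3, 2) y = bishop_dist (1, 1) x' + bishop_dist (3, 2) y'"
      "bishop_dist (1, 1) x + bishop_dist (2, w) y = bishop_dist (1, 1) x' + bishop_dist (2, w) y'"
      "bishop_dist (3, 1) x + bishop_dist (1, 2) y = bishop_dist (3, 1) x' + bishop_dist (1, 2) y'"
      using eq L D by (simp_all only: e us_def distance_vector_def list.map list.inject gd enat.inject)
    \<comment> \<open>Subtracting the first equation of \<open>d\<close> from the second and third
      cancels the light distance to \<open>(1, 1)\<close>.\<close>
    have y: "y = y'"
      by (rule dark_differences_resolve[OF m(2) m'(2) w(1-3)]) (use d in linarith)+
    have "x = x'"
      by (rule light_corners_resolve[OF m(1) m'(1)]) (use d y in simp_all)
    with y e v show False by simp
  qed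
  then show ?thesis
    unfolding metric_dimension_def by (intro Least_le) (auto simp: us_def)
qed

theorem theorem5p5:
  fixes n :: nat
  assumes "n \<ge> 3"
  shows "3 \<le> metric_dimension (with_proj (two_bishop_game_graph 3 n))
       \<and> metric_dimension (with_proj (two_bishop_game_graph 3 n)) \<le> 4"
  using metric_dimension_two_bishop_ge metric_dimension_two_bishop_le assms by blast

end
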